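(* Let $\delta$ be a fixed positive even integer. For every $\varepsilon > 0$ there exists $n_0$ such that, for every graph $G=(V,E)$ with $n \ge n_0$ vertices and $m$ edges belonging to either of the following two families, every bisection $V = V_1 \cup V_2$ of $G$ satisfies $$\max\{e(V_1), e(V_2)\} \ge \left(\frac{\delta+2}{4(\delta+1)} - \varepsilon\right) m .$$ Family 1: all graphs obtained by taking the vertex-disjoint union of an arbitrary number of cliques of order $\delta$ together with an arbitrary number of cliques of order $\delta+1$, and adding a new vertex adjacent to all vertices in the cliques. Family 2: the complete bipartite graphs $K_{\delta+1,\, n-\delta-1}$.
   Context: Graphs are finite and simple. A bisection of a graph is a bipartition $V = V_1 \cup V_2$ of its vertex set into disjoint parts with $\big||V_1|-|V_2|\big| \le 1$. For a vertex set $U$, $e(U)$ is the number of edges with both endpoints in $U$. *)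

theory Defs
  imports Complex_Main "HOL-Library.Disjoint_Sets"
begin

text \<open>A graph is given by its vertex set and its edge set; an edge is a two-element set of vertices.\<close>

definition simple_graph :: "'a set \<Rightarrow> 'a set set \<Rightarrow> bool" where
  "simple_graph V E \<longleftrightarrow> finite V \<and> (\<forall>e\<in>E. e \<subseteq> V \<and> card e = 2)"

definition edges_inside :: "'a set set \<Rightarrow> 'a set \<Rightarrow> nat" where
  "edges_inside E U = card {e \<in> E. e \<subseteq> U}"

definition bisection :: "'a set \<Rightarrow> 'a set \<Rightarrow> 'a set \<Rightarrow> bool" where
  "bisection V V1 V2 \<longleftrightarrow>
     V = V1 \<union> V2 \<and> V1 \<inter> V2 = {} \<and> \<bar>int (card V1) - int (card V2)\<bar> \<le> 1"

definition clique_edges :: "'a set \<Rightarrow> 'a set set" where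
  "clique_edges C = {{x, y} |x y. x \<in> C \<and> y \<in> C \<and> x \<noteq> y}"

text \<open>Here \<open>P\<close> is the collection of the vertex sets of the cliques and \<open>v\<close> is the added vertex.
  As a set, \<open>P\<close> still allows arbitrarily many cliques of each order: for \<open>d > 0\<close> the vertex sets
  are nonempty, so pairwise disjoint ones are distinct.\<close>

definition coned_cliques :: "nat \<Rightarrow> 'a set \<Rightarrow> 'a set set \<Rightarrow> bool" where
  "coned_cliques d V E \<longleftrightarrow>
     (\<exists>P v. finite P \<and> disjoint P \<and> (\<forall>C\<in>P. finite C \<and> (card C = d \<or> card C = d + 1)) \<and>
        v \<notin> \<Union>P \<and>
        V = insert v (\<Union>P) \<and>
        E = (\<Union>C\<in>P. clique_edges C) \<union> {{v, x} |x. x \<in> \<Union>P})"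

definition complete_bipartite :: "nat \<Rightarrow> nat \<Rightarrow> 'a set \<Rightarrow> 'a set set \<Rightarrow> bool" where
  "complete_bipartite p q V E \<longleftrightarrow>
     (\<exists>A B. finite A \<and> finite B \<and> A \<inter> B = {} \<and> card A = p \<and> card B = q \<and>
        V = A \<union> B \<and>
        E = {{a, b} |a b. a \<in> A \<and> b \<in> B})"

end

theory Submission imports Defs begin

text \<open>Write \<open>\<delta> = 2 * h\<close>. In a coned disjoint union of cliques, consider the side of the bisection
  containing the cone vertex. A clique meeting it in \<open>a\<close> vertices contributes \<open>a * (a + 1) / 2\<close>
  edges, and \<open>(a - h) * (a - h - 1) \<ge> 0\<close> for integers bounds this from below by the linear function
  \<open>(h + 1) * (a - h / 2)\<close>. The \<open>a\<close> sum to about half of the vertices, and evaluating the linear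
  function at \<open>a = k / 2\<close> gives exactly the fraction \<open>(\<delta> + 2) / (4 * (\<delta> + 1))\<close> of the
  \<open>k * (k + 1) / 2\<close> edges of a coned clique of either order \<open>k \<in> {\<delta>, \<delta> + 1}\<close>. In the complete
  bipartite graph, one side of the bisection contains at least \<open>h + 1\<close> of the \<open>2 * h + 1\<close> vertices of
  the small class and about half of the large class.\<close>

section \<open>Bisections and the edge sets of cliques\<close>

lemma bisection_sym: "bisection V V1 V2 \<longleftrightarrow> bisection V V2 V1"
  unfolding bisection_def by (auto simp: Un_commute Int_commute)

lemma bisection_card:
  assumes "finite V" "bisection V V1 V2"
  shows "2 * real (card V1) \<ge> real (card V) - 1"
proof -
  have "V = V1 \<union> V2" "V1 \<inter> V2 = {}" and d: "\<bar>int (card V1) - int (card V2)\<bar> \<le> 1"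
    using assms(2) by (auto simp: bisection_def)
  then have "card V = card V1 + card V2"
    using assms(1) by (simp add: card_Un_disjoint)
  with d show ?thesis by linarith
qed

lemma clique_edges_eq: "clique_edges C = {e. e \<subseteq> C \<and> card e = 2}"
  unfolding clique_edges_def by (auto simp: card_2_iff)

lemma clique_edges_insert:
  assumes "v \<notin> C"
  shows "clique_edges (insert v C) = clique_edges C \<union> {{v, x} |x. x \<in> C}"
proof (intro equalityI subsetI)
  fix e assume "e \<in> clique_edges (insert v C)"
  then obtain x y where "e = {x, y}" "x \<in> insert v C" "y \<in> insert v C" "x \<noteq> y"
    by (auto simp: clique_edges_def)
  then show "e \<in> clique_edges C \<union> {{v, x} |x. x \<in> C}"
    by (cases "x = v"; cases "y = v") (auto simp: clique_edges_def insert_commute)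
next
  fix e assume "e \<in> clique_edges C \<union> {{v, x} |x. x \<in> C}"
  then show "e \<in> clique_edges (insert v C)"
    using assms by (auto simp: clique_edges_eq card_insert_if)
qed

lemma card_clique_edges: "finite C \<Longrightarrow> card (clique_edges C) = card C choose 2"
  by (simp add: clique_edges_eq n_subsets)

text \<open>Cliques coned at \<open>v\<close> pairwise meet only in \<open>v\<close>, so they share
  no edge and their edge counts add up. \<open>W\<close> is a side of the bisection for the edges
  inside that side, and \<open>UNIV\<close> for all edges.\<close>

lemma card_UN_cone_cliques:
  assumes "finite P" "disjoint P" "\<And>C. C \<in> P \<Longrightarrow> finite C" "v \<notin> \<Union>P"
  shows "card (\<Union>C\<in>P. clique_edges (insert v (C \<inter> W)))
           = (\<Sum>C\<in>P. Suc (card (C \<inter> W)) choose 2)"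
proof -
  have disj: "clique_edges (insert v (C \<inter> W)) \<inter> clique_edges (insert v (D \<inter> W)) = {}"
    if "C \<in> P" "D \<in> P" "C \<noteq> D" for C D
  proof (rule ccontr)
    assume "\<not> ?thesis"
    then obtain e where e: "e \<subseteq> insert v C" "e \<subseteq> insert v D" "card e = 2"
      by (auto simp: clique_edges_eq)
    have "C \<inter> D = {}" using disjointD[OF assms(2) that] .
    with e have "e \<subseteq> {v}" by blast
    then have "card e \<le> 1" by (metis card_mono finite.simps is_singletonI is_singleton_altdef)
    with e show False by simp
  qed
  have "card (\<Union>C\<in>P. clique_edges (insert v (C \<inter> W)))
          = (\<Sum>C\<in>P. card (clique_edges (insert v (C \<inter> W))))"
    using assms disj
    by (intro card_UN_disjoint) (auto simp: clique_edges_eq)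
  also have "\<dots> = (\<Sum>C\<in>P. Suc (card (C \<inter> W)) choose 2)"
  proof (rule sum.cong[OF refl])
    fix C assume C: "C \<in> P"
    then have "finite (C \<inter> W)" "v \<notin> C \<inter> W" using assms by auto
    then show "card (clique_edges (insert v (C \<inter> W))) = Suc (card (C \<inter> W)) choose 2"
      by (subst card_clique_edges) auto
  qed
  finally show ?thesis .
qed

lemma real_Suc_choose_2: "real (Suc k choose 2) = real k * (real k + 1) / 2"
proof -
  have "2 * (Suc k choose 2) = k * (k + 1)" by (simp add: choose_two)
  then have "real (2 * (Suc k choose 2)) = real (k * (k + 1))" by (rule arg_cong)
  then show ?thesis by (simp add: field_simps)
qed

text \<open>The difference of the two sides is \<open>(a - h) * (a - h - 1) / 2\<close>, half a
  product of consecutive integers. The line is the secant through \<open>a = h\<close> and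
  \<open>a = h + 1\<close>; between these points the inequality fails, so integrality of
  \<open>a\<close> matters.\<close>

lemma triangular_ge_secant:
  "real a * (real a + 1) / 2 \<ge> (real h + 1) * (real a - real h / 2)"
proof -
  have "(int a - int h) * (int a - int h - 1) \<ge> 0"
    by (cases "int a \<le> int h") (auto simp: mult_nonpos_nonpos)
  then have "real_of_int ((int a - int h) * (int a - int h - 1)) \<ge> 0"
    using of_int_0_le_iff by blast
  then have "(real a - real h) * (real a - real h - 1) \<ge> 0" by simp
  then show ?thesis by (simp add: field_simps)
qed

section \<open>Coned cliques: the side containing the cone vertex\<close>

text \<open>The loss \<open>h + 1\<close> is the slope of the secant times the deficit 1 in
  \<open>half\<close>. The second claim makes \<open>m\<close> large when \<open>n\<close> is large,
  so that \<open>\<epsilon> * m\<close> can absorb this loss.\<close>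

lemma coned_cliques_side:
  fixes h :: nat
  assumes P: "finite P" "disjoint P" "\<And>C. C \<in> P \<Longrightarrow> finite C"
      "\<And>C. C \<in> P \<Longrightarrow> card C = 2 * h \<or> card C = 2 * h + 1"
    and v: "v \<notin> \<Union>P" and V: "V = insert v (\<Union>P)"
    and E: "E = (\<Union>C\<in>P. clique_edges C) \<union> {{v, x} |x. x \<in> \<Union>P}"
    and bis: "bisection V V1 V2" and vV1: "v \<in> V1"
  shows "real (edges_inside E V1)
           \<ge> (real h + 1) / (2 * (2 * real h + 1)) * real (card E) - (real h + 1)"
    and "card V \<le> card E + 1"
proof -
  have finV: "finite V" using P V by auto
  have V1: "V1 \<subseteq> V" using bis by (auto simp: bisection_def)
  have E': "E = (\<Union>C\<in>P. clique_edges (insert v C))"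
  proof -
    have "clique_edges (insert v C) = clique_edges C \<union> {{v, x} |x. x \<in> C}" if "C \<in> P" for C
      using v that by (intro clique_edges_insert) auto
    then have "(\<Union>C\<in>P. clique_edges (insert v C)) = (\<Union>C\<in>P. clique_edges C \<union> {{v, x} |x. x \<in> C})"
      by (rule SUP_cong[OF refl])
    also have "\<dots> = E" unfolding E by blast
    finally show ?thesis by simp
  qed
  \<comment> \<open>Since \<open>v\<close> lies in \<open>V1\<close>, the part of a coned clique
    inside \<open>V1\<close> is again a coned clique, with base
    \<open>C \<inter> V1\<close>.\<close>
  have inside: "{e \<in> E. e \<subseteq> V1} = (\<Union>C\<in>P. clique_edges (insert v (C \<inter> V1)))"
    using vV1 unfolding E' clique_edges_eq by auto
  define a where "a C = real (card (C \<inter> V1))" for C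
  define k where "k C = real (card C)" for C :: "'a set"
  have e1: "real (edges_inside E V1) = (\<Sum>C\<in>P. a C * (a C + 1) / 2)"
    unfolding edges_inside_def inside a_def
    using card_UN_cone_cliques[OF P(1-3) v, of V1] by (simp add: real_Suc_choose_2)
  have m: "real (card E) = (\<Sum>C\<in>P. k C * (k C + 1) / 2)"
    unfolding E' k_def
    using card_UN_cone_cliques[OF P(1-3) v, of UNIV] by (simp add: real_Suc_choose_2)
  have n: "real (card V) = (\<Sum>C\<in>P. k C) + 1"
  proof -
    have "card (\<Union>P) = (\<Sum>C\<in>P. card C)"
      using P by (intro card_Union_disjoint) (auto simp: disjoint_def pairwise_def disjnt_def)
    moreover have "card V = Suc (card (\<Union>P))" using V v finV by simp
    ultimately show ?thesis by (simp add: k_def)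
  qed
  have n1: "real (card V1) = (\<Sum>C\<in>P. a C) + 1"
  proof -
    have "V1 = insert v (\<Union>C\<in>P. C \<inter> V1)" using V V1 vV1 by auto
    moreover have "v \<notin> (\<Union>C\<in>P. C \<inter> V1)" "finite (\<Union>C\<in>P. C \<inter> V1)" using v P by auto
    ultimately have "card V1 = Suc (card (\<Union>C\<in>P. C \<inter> V1))" by (metis card_insert_disjoint)
    moreover have "card (\<Union>C\<in>P. C \<inter> V1) = (\<Sum>C\<in>P. card (C \<inter> V1))"
      using P by (intro card_UN_disjoint) (auto simp: disjoint_def)
    ultimately show ?thesis by (simp add: a_def)
  qed
  \<comment> \<open>\<open>V1\<close> spends one place on \<open>v\<close>: twice (sum of
    \<open>a\<close>, plus 1) is at least (sum of \<open>k\<close>, plus 1) minus 1.\<close>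
  have half: "(\<Sum>C\<in>P. a C) \<ge> (\<Sum>C\<in>P. k C / 2) - 1"
    using bisection_card[OF finV bis] n n1 by (simp flip: sum_divide_distrib)
  define c where "c = (real h + 1) / (2 * (2 * real h + 1))"
  have clique: "c * (k C * (k C + 1) / 2) = (real h + 1) * (k C / 2 - real h / 2)"
    if "C \<in> P" for C
  proof -
    have "k C = 2 * real h \<or> k C = 2 * real h + 1" using P(4)[OF that] by (auto simp: k_def)
    moreover have "2 * real h + 1 \<noteq> 0" by linarith
    ultimately show ?thesis unfolding c_def by (elim disjE) (simp_all add: field_simps)
  qed
  have "c * real (card E) = (\<Sum>C\<in>P. (real h + 1) * (k C / 2 - real h / 2))"
    unfolding m sum_distrib_left using clique by (rule sum.cong[OF refl])
  also have "\<dots> = (real h + 1) * ((\<Sum>C\<in>P. k C / 2) - (\<Sum>C\<in>P. real h / 2))"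
    by (simp only: sum_distrib_left[symmetric] sum_subtractf)
  also have "\<dots> \<le> (real h + 1) * ((\<Sum>C\<in>P. a C) + 1 - (\<Sum>C\<in>P. real h / 2))"
    using half by (intro mult_left_mono) auto
  also have "\<dots> = (\<Sum>C\<in>P. (real h + 1) * (a C - real h / 2)) + (real h + 1)"
    by (simp only: sum_distrib_left[symmetric] sum_subtractf) (simp add: algebra_simps)
  also have "(\<Sum>C\<in>P. (real h + 1) * (a C - real h / 2)) \<le> (\<Sum>C\<in>P. a C * (a C + 1) / 2)"
    using triangular_ge_secant by (intro sum_mono) (simp add: a_def)
  finally show "real (edges_inside E V1) \<ge> (real h + 1) / (2 * (2 * real h + 1)) * real (card E) - (real h + 1)"
    using e1 by (simp add: c_def)
  have "(\<Sum>C\<in>P. k C) \<le> (\<Sum>C\<in>P. k C * (k C + 1) / 2)"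
  proof (rule sum_mono)
    fix C
    show "k C \<le> k C * (k C + 1) / 2"
      \<comment> \<open>The secant for \<open>h = 0\<close> is the identity line.\<close>
      using triangular_ge_secant[of 0 "card C"] by (simp add: k_def)
  qed
  then show "card V \<le> card E + 1" using m n by linarith
qed

section \<open>Complete bipartite graphs: the side with most of the small class\<close>

lemma complete_bipartite_side:
  fixes h :: nat
  assumes AB: "finite A" "finite B" "A \<inter> B = {}" and V: "V = A \<union> B"
    and E: "E = {{a, b} |a b. a \<in> A \<and> b \<in> B}"
    and cA: "card A = 2 * h + 1"
    and bis: "bisection V V1 V2" and big: "card (A \<inter> V1) \<ge> h + 1"
  shows "real (edges_inside E V1) \<ge> (real h + 1) * (real (card B) / 2 - (real h + 1))"
    and "card E = (2 * h + 1) * card B"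
proof -
  have card_edges: "card {{a, b} |a b. a \<in> S \<and> b \<in> T} = card S * card T"
    if "S \<subseteq> A" "T \<subseteq> B" for S T
  proof -
    have "{{a, b} |a b. a \<in> S \<and> b \<in> T} = (\<lambda>(a, b). {a, b}) ` (S \<times> T)" by auto
    \<comment> \<open>Disjointness of \<open>A\<close> and \<open>B\<close> determines which end of
      an edge lies in which class.\<close>
    moreover have "inj_on (\<lambda>(a, b). {a, b}) (S \<times> T)"
      using that AB(3) by (auto simp: inj_on_def doubleton_eq_iff)
    ultimately show ?thesis by (simp add: card_image card_cartesian_product)
  qed
  show "card E = (2 * h + 1) * card B" using card_edges[of A B] E cA by simp
  have "{e \<in> E. e \<subseteq> V1} = {{a, b} |a b. a \<in> A \<inter> V1 \<and> b \<in> B \<inter> V1}"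
    unfolding E by auto
  then have e1: "edges_inside E V1 = card (A \<inter> V1) * card (B \<inter> V1)"
    using card_edges[of "A \<inter> V1" "B \<inter> V1"] unfolding edges_inside_def by simp
  have "V1 = (A \<inter> V1) \<union> (B \<inter> V1)" using bis V by (auto simp: bisection_def)
  then have "card V1 = card (A \<inter> V1) + card (B \<inter> V1)"
    using AB by (metis card_Un_disjoint finite_Int inf_assoc inf_bot_left inf_left_commute)
  moreover have "2 * real (card V1) \<ge> real (card V) - 1"
    using bisection_card[OF _ bis] V AB by simp
  moreover have "card V = 2 * h + 1 + card B" using V AB cA by (simp add: card_Un_disjoint)
  moreover have "card (A \<inter> V1) \<le> 2 * h + 1" using cA AB by (metis card_mono inf_le1)
  \<comment> \<open>Even if all \<open>2 * h + 1\<close> vertices of \<open>A\<close> lie in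
    \<open>V1\<close>, at least \<open>(card B + 2 * h) / 2 - (2 * h + 1)\<close> places remain for
    \<open>B\<close>.\<close>
  ultimately have b: "real (card (B \<inter> V1)) \<ge> real (card B) / 2 - (real h + 1)"
    by simp
  \<comment> \<open>The factor for \<open>B\<close> is replaced first: its lower bound may be
    negative, whereas \<open>card (B \<inter> V1)\<close> allows the other factor to be
    enlarged.\<close>
  have "(real h + 1) * (real (card B) / 2 - (real h + 1)) \<le> (real h + 1) * real (card (B \<inter> V1))"
    using b by (intro mult_left_mono) auto
  also have "\<dots> \<le> real (card (A \<inter> V1)) * real (card (B \<inter> V1))"
    using big by (intro mult_right_mono) linarith+
  finally show "real (edges_inside E V1) \<ge> (real h + 1) * (real (card B) / 2 - (real h + 1))"
    using e1 by simp
qed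

section \<open>Bounds for the larger of the two sides\<close>

lemma coned_cliques_bound:
  assumes G: "coned_cliques (2 * h) V E" and bis: "bisection V V1 V2"
  shows "real (max (edges_inside E V1) (edges_inside E V2))
           \<ge> (real h + 1) / (2 * (2 * real h + 1)) * real (card E) - (real h + 1)"
    and "card V \<le> card E + 1"
proof -
  obtain P v where P: "finite P" "disjoint P"
      "\<And>C. C \<in> P \<Longrightarrow> finite C" "\<And>C. C \<in> P \<Longrightarrow> card C = 2 * h \<or> card C = 2 * h + 1"
      "v \<notin> \<Union>P" "V = insert v (\<Union>P)"
      "E = (\<Union>C\<in>P. clique_edges C) \<union> {{v, x} |x. x \<in> \<Union>P}"
    using G unfolding coned_cliques_def by blast
  have "v \<in> V1 \<or> v \<in> V2" using bis P(6) by (auto simp: bisection_def)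
  then have "real (max (edges_inside E V1) (edges_inside E V2))
           \<ge> (real h + 1) / (2 * (2 * real h + 1)) * real (card E) - (real h + 1)
         \<and> card V \<le> card E + 1"
  proof
    assume "v \<in> V1"
    from coned_cliques_side[OF P bis this] show ?thesis by linarith
  next
    assume "v \<in> V2"
    from coned_cliques_side[OF P iffD1[OF bisection_sym bis] this] show ?thesis by linarith
  qed
  then show "real (max (edges_inside E V1) (edges_inside E V2))
           \<ge> (real h + 1) / (2 * (2 * real h + 1)) * real (card E) - (real h + 1)"
    and "card V \<le> card E + 1" by auto
qed

lemma complete_bipartite_bound:
  assumes G: "complete_bipartite (2 * h + 1) q V E" and bis: "bisection V V1 V2"
  shows "real (max (edges_inside E V1) (edges_inside E V2))
           \<ge> (real h + 1) * (real q / 2 - (real h + 1))"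
    and "card E = (2 * h + 1) * q"
proof -
  obtain A B where AB: "finite A" "finite B" "A \<inter> B = {}" and q: "card B = q"
      and V: "V = A \<union> B" and E: "E = {{a, b} |a b. a \<in> A \<and> b \<in> B}"
      and cA: "card A = 2 * h + 1"
    using G unfolding complete_bipartite_def by blast
  have "A = (A \<inter> V1) \<union> (A \<inter> V2)" "(A \<inter> V1) \<inter> (A \<inter> V2) = {}"
    using bis V by (auto simp: bisection_def)
  then have "card A = card (A \<inter> V1) + card (A \<inter> V2)"
    using AB by (metis card_Un_disjoint finite_Int)
  \<comment> \<open>Two parts of size at most \<open>h\<close> cannot make up
    \<open>2 * h + 1\<close> vertices.\<close>
  then have "card (A \<inter> V1) \<ge> h + 1 \<or> card (A \<inter> V2) \<ge> h + 1" using cA by linarith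
  then have "real (max (edges_inside E V1) (edges_inside E V2))
           \<ge> (real h + 1) * (real q / 2 - (real h + 1)) \<and> card E = (2 * h + 1) * q"
  proof
    assume "card (A \<inter> V1) \<ge> h + 1"
    from complete_bipartite_side[OF AB V E cA bis this] q show ?thesis by auto
  next
    assume "card (A \<inter> V2) \<ge> h + 1"
    from complete_bipartite_side[OF AB V E cA iffD1[OF bisection_sym bis] this] q
    show ?thesis by auto
  qed
  then show "real (max (edges_inside E V1) (edges_inside E V2))
           \<ge> (real h + 1) * (real q / 2 - (real h + 1))"
    and "card E = (2 * h + 1) * q" by auto
qed

theorem proposition1p10:
  fixes \<delta> :: nat
  assumes "\<delta> > 0" and "even \<delta>"
  shows "\<forall>\<epsilon>::real. \<epsilon> > 0 \<longrightarrow> (\<exists>n0::nat. \<forall>(V :: 'a set) E n m.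
           simple_graph V E \<and> n = card V \<and> m = card E \<and> n \<ge> n0 \<and>
           (coned_cliques \<delta> V E \<or> complete_bipartite (\<delta> + 1) (n - \<delta> - 1) V E) \<longrightarrow>
           (\<forall>V1 V2. bisection V V1 V2 \<longrightarrow>
              real (max (edges_inside E V1) (edges_inside E V2))
                \<ge> ((real \<delta> + 2) / (4 * (real \<delta> + 1)) - \<epsilon>) * real m))"
proof (intro allI impI)
  fix \<epsilon> :: real assume eps: "\<epsilon> > 0"
  obtain h where d: "\<delta> = 2 * h" using assms(2) by blast
  define c where "c = (real h + 1) / (2 * (2 * real h + 1))"
  have c: "(real \<delta> + 2) / (4 * (real \<delta> + 1)) = c"
    unfolding c_def d by (simp add: divide_simps add_eq_0_iff_both_eq_0, simp add: algebra_simps)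
  \<comment> \<open>Both families fall short of \<open>c * m\<close> by a constant:
    \<open>h + 1\<close> for coned cliques, \<open>(h + 1)\<^sup>2\<close> for bipartite graphs. The
    larger one fixes the number \<open>K\<close> of edges after which \<open>\<epsilon> * m\<close>
    covers either loss.\<close>
  obtain K :: nat where K: "real K \<ge> (real h + 1)\<^sup>2 / \<epsilon>" using real_arch_simple by blast
  then have K: "\<epsilon> * real K \<ge> (real h + 1)\<^sup>2" using eps by (simp add: field_simps)
  have sq: "(real h + 1)\<^sup>2 \<ge> real h + 1" by (simp add: power2_eq_square)
  have conclude: "x \<ge> (c - \<epsilon>) * real m"
    if "x \<ge> c * real m - (real h + 1)\<^sup>2" "K \<le> m" for x and m :: nat
  proof -
    have "\<epsilon> * real K \<le> \<epsilon> * real m" using that eps by (intro mult_left_mono) auto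
    with K that show ?thesis by (simp add: algebra_simps)
  qed
  show "\<exists>n0::nat. \<forall>(V :: 'a set) E n m.
           simple_graph V E \<and> n = card V \<and> m = card E \<and> n \<ge> n0 \<and>
           (coned_cliques \<delta> V E \<or> complete_bipartite (\<delta> + 1) (n - \<delta> - 1) V E) \<longrightarrow>
           (\<forall>V1 V2. bisection V V1 V2 \<longrightarrow>
              real (max (edges_inside E V1) (edges_inside E V2))
                \<ge> ((real \<delta> + 2) / (4 * (real \<delta> + 1)) - \<epsilon>) * real m)"
  \<comment> \<open>With this threshold \<open>m \<ge> K\<close> in both families: coned cliques
    have \<open>m \<ge> n - 1\<close>, and in the bipartite case \<open>n - \<delta> - 1\<close> is
    an untruncated difference of at least \<open>K\<close>.\<close>
  proof (intro exI[of _ "K + \<delta> + 1"] allI impI, elim conjE)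
    fix V :: "'a set" and E n m V1 V2
    assume n: "n = card V" "K + \<delta> + 1 \<le> n" and m: "m = card E"
      and bis: "bisection V V1 V2"
      and "coned_cliques \<delta> V E \<or> complete_bipartite (\<delta> + 1) (n - \<delta> - 1) V E"
    then consider "coned_cliques (2 * h) V E" | "complete_bipartite (2 * h + 1) (n - \<delta> - 1) V E"
      by (auto simp: d)
    then show "real (max (edges_inside E V1) (edges_inside E V2))
                \<ge> ((real \<delta> + 2) / (4 * (real \<delta> + 1)) - \<epsilon>) * real m"
    proof cases
      case 1
      from coned_cliques_bound[OF this bis] n m sq show ?thesis
        unfolding c by (intro conclude) (simp_all add: c_def)
    next
      case 2
      define q where "q = n - \<delta> - 1"
      note b = complete_bipartite_bound[OF 2[folded q_def] bis]
      have "K \<le> q" using n by (simp add: q_def)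
      then have "K \<le> m" using b(2) m by (simp add: trans_le_add1)
      \<comment> \<open>The denominator of \<open>c\<close> cancels the factor
        \<open>2 * h + 1\<close> in \<open>m\<close>, so the bipartite bound is exactly
        \<open>c * m - (h + 1)\<^sup>2\<close>.\<close>
      moreover have "c * real m = (real h + 1) * (real q / 2)"
      proof -
        have "2 * real h + 1 \<noteq> 0" by linarith
        then show ?thesis unfolding m b(2) c_def by (simp add: field_simps)
      qed
      ultimately show ?thesis
        using b(1) unfolding c by (intro conclude) (simp_all add: power2_eq_square algebra_simps)
    qed
  qed
qed

end
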